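(* Let $q$ be a prime power, $n\ge 1$, and let $f(x)$ be a monic irreducible polynomial of degree $2n$ over $\mathbb{F}_q$ of order $e(q^n+1)$ for some positive integer $e$. (a) Let $\alpha\in\mathbb{F}_{q^{2n}}$ be a zero of $f(x)$ and set $\beta=\alpha^e$. Then $x^{q^n+1}+x^{q^n}-(\beta^{q^n}+\beta+1)x+1$ is an irreducible polynomial over $\mathbb{F}_{q^n}$. (b) Let $R(x)$ be the remainder of $x^{eq^n}+x^e+1$ modulo $f(x)$, and let $\psi(x)=\sum_{u=0}^n\psi_u x^u\in\mathbb{F}_q[x]$ be the monic nonzero polynomial of least degree satisfying $\sum_{u=0}^{n}\psi_u (R(x))^u\equiv 0\pmod{f(x)}$. Then $\psi(x)$ is an irreducible polynomial of degree $n$ over $\mathbb{F}_q$. (c) With $\psi$ as in (b), the polynomial $$F(x)=x^n\,\psi\!\left(\frac{x^{q^n+1}+x^{q^n}+1}{x}\right)$$ is an irreducible polynomial of degree $n(q^n+1)$ over $\mathbb{F}_q$.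
   Context: The order of a polynomial $P(x)\in\mathbb{F}_q[x]$ with $P(0)\ne0$ is the least positive integer $t$ such that $P(x)$ divides $x^t-1$; for irreducible $P$ it equals the multiplicative order of any root of $P$. *)

theory Defs
  imports "HOL-Computational_Algebra.Computational_Algebra"
begin

definition field_hom :: "('a::field \<Rightarrow> 'b::field) \<Rightarrow> bool" where
  "field_hom h \<longleftrightarrow> h 1 = 1 \<and> (\<forall>x y. h (x + y) = h x + h y) \<and> (\<forall>x y. h (x * y) = h x * h y)"

definition poly_ord :: "'a::field poly \<Rightarrow> nat" where
  "poly_ord P = (LEAST t. 0 < t \<and> P dvd (monom 1 t - 1))"

text \<open>F(x) = x^n psi((x^(Q+1) + x^Q + 1)/x), written out as a polynomial:
  sum over u \<le> n of psi_u (x^(Q+1)+x^Q+1)^u x^(n-u).\<close>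
definition F_poly :: "nat \<Rightarrow> nat \<Rightarrow> 'a::field poly \<Rightarrow> 'a poly" where
  "F_poly n Q psi = (\<Sum>u\<le>n. smult (coeff psi u)
      ((monom 1 (Q + 1) + monom 1 Q + 1) ^ u * monom 1 (n - u)))"

end

(*
  Put Q = q^n, b = alpha^e and c = b^Q + b + 1. Then b has order Q + 1, so b^Q = 1/b.
  A root y of x^(Q+1) + x^Q - c x + 1 satisfies y^Q = (c y - 1)/(y + 1), so the Q-th power map
  acts on y as a Moebius transformation with fixed points b and 1/b and multiplier 1/b;
  the orbit of y under it therefore has length Q + 1. The orbit of c under the q-th power map has
  length n, so psi is the minimal polynomial of c over F_q, and y is a root of F whose orbit
  under the q-th power map has length n(Q + 1). A polynomial of degree d having a root with
  d conjugates is irreducible.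
*)
theory Submission
  imports "HOL-Algebra.Algebraic_Closure_Type" Defs
begin

section \<open>Finite fields: power identity and vanishing binomial coefficients\<close>

lemma finite_field_power_card:
  fixes x :: "'a::{field,finite}"
  shows "x ^ card (UNIV :: 'a set) = x"
proof (cases "x = 0")
  case False
  \<comment> \<open>Multiplication by \<open>x\<close> permutes the nonzero elements; comparing the
    product of all of them before and after gives the identity.\<close>
  have "bij_betw ((*) x) (- {0}) (- {0})"
    by (rule bij_betwI[of _ _ _ "\<lambda>y. y / x"]) (use False in auto)
  hence "\<Prod>(- {0}) = (\<Prod>y\<in>- {0}. x * y)"
    using prod.reindex_bij_betw[of "(*) x" "- {0}" "- {0}" "\<lambda>y. y"] by simp
  also have "\<dots> = x ^ card (- {0} :: 'a set) * \<Prod>(- {0})"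
    by (simp add: prod.distrib)
  finally have "x ^ card (- {0} :: 'a set) = 1"
    by simp
  moreover have "card (UNIV :: 'a set) = Suc (card (- {0} :: 'a set))"
    using card_Suc_Diff1[of UNIV "0 :: 'a"] by (simp add: Compl_eq_Diff_UNIV)
  ultimately show ?thesis
    by simp
qed (simp add: finite_UNIV_card_ge_0)

lemma finite_field_card_ge_2: "card (UNIV :: 'a::{field,finite} set) \<ge> 2"
  using card_mono[of "UNIV :: 'a set" "{0,1}"] by simp

text \<open>The polynomial \<open>(X + 1)^q - X^q - 1\<close> has degree below \<open>q\<close> and vanishes on a field with
  \<open>q\<close> elements.\<close>
lemma finite_field_binomial_eq_0:
  assumes "0 < i" "i < card (UNIV :: 'a::{field,finite} set)"
  shows "of_nat (card (UNIV :: 'a set) choose i) = (0 :: 'a)"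
proof -
  define q where "q = card (UNIV :: 'a set)"
  define P :: "'a poly" where "P = (\<Sum>i\<in>{1..<q}. monom (of_nat (q choose i)) i)"
  have "poly P a = 0" for a
  proof -
    have "(a + 1) ^ q = (\<Sum>i\<le>q. of_nat (q choose i) * a ^ i)"
      by (simp add: binomial_ring)
    also have "{..q} = insert 0 (insert q {1..<q})"
      by auto
    also have "(\<Sum>i\<in>insert 0 (insert q {1..<q}). of_nat (q choose i) * a ^ i) = 1 + a ^ q + poly P a"
      using finite_field_card_ge_2[where ?'a = 'a]
      by (subst sum.insert; simp add: P_def poly_sum poly_monom q_def)+
    finally show ?thesis
      by (simp add: q_def finite_field_power_card)
  qed
  moreover have "degree P < q"
  proof -
    have "degree P \<le> q - 1"
      unfolding P_def by (intro degree_sum_le) (auto intro: order.trans[OF degree_monom_le])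
    thus ?thesis
      using finite_field_card_ge_2[where ?'a = 'a] by (simp add: q_def)
  qed
  ultimately have "P = 0"
    using finite_field_card_ge_2[where ?'a = 'a]
    by (intro poly_eqI_degree[of UNIV]) (auto simp: q_def)
  hence "coeff P i = 0"
    by simp
  thus ?thesis
    using assms by (simp add: P_def coeff_sum q_def)
qed

section \<open>Field embeddings and evaluation of polynomials along them\<close>

locale field_embedding =
  fixes h :: "'a::field \<Rightarrow> 'b::field"
  assumes field_hom: "field_hom h"
begin

lemma hom_1 [simp]: "h 1 = 1" and hom_add [simp]: "h (x + y) = h x + h y"
  and hom_mult [simp]: "h (x * y) = h x * h y"
  using field_hom by (auto simp: field_hom_def)

lemma hom_0 [simp]: "h 0 = 0"
  using hom_add[of 0 0] by (metis add.right_neutral add_left_cancel)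

lemma hom_uminus [simp]: "h (- x) = - h x"
  using hom_add[of x "- x"] by (simp add: eq_neg_iff_add_eq_0 add.commute)

lemma hom_diff [simp]: "h (x - y) = h x - h y"
  using hom_add[of x "- y"] by simp

lemma hom_of_nat [simp]: "h (of_nat m) = of_nat m"
  by (induction m) auto

lemma hom_eq_0_iff [simp]: "h x = 0 \<longleftrightarrow> x = 0"
proof
  assume "h x = 0"
  thus "x = 0"
    using hom_mult[of x "inverse x"] by (cases "x = 0") (auto simp del: hom_mult)
qed simp

lemma degree_map_poly_hom [simp]: "degree (map_poly h p) = degree p"
  by (rule degree_map_poly) simp

lemma map_poly_hom_eq_0_iff [simp]: "map_poly h p = 0 \<longleftrightarrow> p = 0"
  by (simp add: map_poly_eq_0_iff)

abbreviation ev :: "'a poly \<Rightarrow> 'b \<Rightarrow> 'b" where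
  "ev p y \<equiv> poly (map_poly h p) y"

lemma ev_pCons [simp]: "ev (pCons a p) y = h a + y * ev p y"
  by (simp add: map_poly_pCons)

lemma ev_add [simp]: "ev (p + p') y = ev p y + ev p' y"
proof (induction p arbitrary: p')
  case (pCons a p)
  thus ?case
    by (cases p') (simp add: algebra_simps)
qed simp

lemma ev_smult [simp]: "ev (smult a p) y = h a * ev p y"
  by (induction p) (auto simp: algebra_simps)

lemma ev_mult [simp]: "ev (p * p') y = ev p y * ev p' y"
  by (induction p) (auto simp: algebra_simps)

lemma ev_uminus [simp]: "ev (- p) y = - ev p y"
  by (induction p) auto

lemma ev_diff [simp]: "ev (p - p') y = ev p y - ev p' y"
  using ev_add[of p "- p'"] by simp

lemma ev_1 [simp]: "ev 1 y = 1"
  by simp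

lemma ev_power [simp]: "ev (p ^ m) y = ev p y ^ m"
  by (induction m) auto

lemma ev_monom [simp]: "ev (monom a m) y = h a * y ^ m"
  by (simp add: map_poly_monom poly_monom)

lemma ev_sum: "ev (\<Sum>i\<in>A. p i) y = (\<Sum>i\<in>A. ev (p i) y)"
  by (induction A rule: infinite_finite_induct) auto

lemma ev_pcompose: "ev (pcompose p r) y = ev p (ev r y)"
  by (induction p) (auto simp: pcompose_pCons)

lemma ev_mod: "ev g y = 0 \<Longrightarrow> ev (p mod g) y = ev p y"
  using ev_add[of "p div g * g" "p mod g" y] by (simp del: ev_add)

lemma ev_altdef: "ev p y = (\<Sum>i\<le>degree p. h (coeff p i) * y ^ i)"
  by (simp add: poly_altdef coeff_map_poly)

text \<open>The elements of minimal degree among the nonzero polynomials vanishing at \<open>y\<close> divide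
  every polynomial vanishing at \<open>y\<close>; an irreducible \<open>f\<close> is associated to such an element.\<close>
lemma irreducible_dvd_if_common_root:
  assumes "irreducible f" "ev f y = 0" "ev g y = 0"
  shows "f dvd g"
proof -
  define d where "d = (LEAST d. \<exists>p. p \<noteq> 0 \<and> ev p y = 0 \<and> degree p = d)"
  have "f \<noteq> 0"
    using assms(1) by auto
  hence "\<exists>p. p \<noteq> 0 \<and> ev p y = 0 \<and> degree p = d"
    unfolding d_def using assms(2) by (intro LeastI) blast
  then obtain m where m: "m \<noteq> 0" "ev m y = 0" "degree m = d"
    by blast
  have dvd: "m dvd p" if "ev p y = 0" for p
  proof (rule ccontr)
    assume "\<not> m dvd p"
    hence nz: "p mod m \<noteq> 0"
      by (simp add: mod_eq_0_iff_dvd)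
    have "d \<le> degree (p mod m)"
      unfolding d_def using nz that m(2) by (intro Least_le) (auto simp: ev_mod)
    thus False
      using degree_mod_less[OF m(1), of p] nz m(3) by simp
  qed
  have "\<not> is_unit m"
    using m(1,2) by (auto simp: is_unit_poly_iff)
  hence "f dvd m"
    using dvd[OF assms(2)] assms(1) by (meson irreducibleD')
  thus ?thesis
    using dvd[OF assms(3)] by (rule dvd_trans)
qed

end

section \<open>Frobenius orbits over a finite base field\<close>

locale finite_field_embedding = field_embedding h
  for h :: "'a::{field,finite} \<Rightarrow> 'b::field" +
  fixes q :: nat
  assumes q_eq_card: "q = card (UNIV :: 'a set)"
begin

lemma q_ge_2: "q \<ge> 2"
  unfolding q_eq_card by (rule finite_field_card_ge_2)

lemma q_pos [simp]: "q > 0" "q \<noteq> 0"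
  using q_ge_2 by auto

lemma frobenius_hom: "h a ^ q = h a"
proof -
  have "h a ^ m = h (a ^ m)" for m
    by (induction m) auto
  thus ?thesis
    by (simp add: q_eq_card finite_field_power_card)
qed

text \<open>The inner binomial coefficients vanish in the base field \<open>'a\<close>, and
  \<open>h\<close> carries this over to \<open>'b\<close>; this avoids writing \<open>q\<close> as a
  prime power.\<close>

lemma frobenius_add: "(x + y) ^ q = x ^ q + (y :: 'b) ^ q"
proof -
  have eq: "{..q} = insert 0 (insert q {1..<q})"
    by auto
  have "(\<Sum>i\<in>{1..<q}. of_nat (q choose i) * x ^ i * y ^ (q - i)) = 0"
  proof (intro sum.neutral ballI)
    fix i assume "i \<in> {1..<q}"
    hence "of_nat (q choose i) = (0 :: 'a)"
      unfolding q_eq_card by (intro finite_field_binomial_eq_0) auto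
    hence "of_nat (q choose i) = (0 :: 'b)"
      by (metis hom_of_nat hom_0)
    thus "of_nat (q choose i) * x ^ i * y ^ (q - i) = 0"
      by simp
  qed
  thus ?thesis
    using q_ge_2 by (simp add: binomial_ring eq)
qed

lemma frobenius_power_add: "(x + y) ^ (q ^ i) = x ^ (q ^ i) + (y :: 'b) ^ (q ^ i)"
proof (induction i)
  case (Suc i)
  have "(x + y) ^ (q ^ Suc i) = ((x + y) ^ (q ^ i)) ^ q"
    by (simp add: mult.commute flip: power_mult)
  also have "\<dots> = (x ^ (q ^ i)) ^ q + (y ^ (q ^ i)) ^ q"
    by (simp only: Suc.IH frobenius_add)
  finally show ?case
    by (simp add: mult.commute flip: power_mult)
qed simp

lemma frobenius_power_inj:
  fixes x y :: 'b
  assumes "x ^ (q ^ i) = y ^ (q ^ i)"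
  shows "x = y"
  using frobenius_power_add[of "x - y" y i] assms q_ge_2 by simp

text \<open>Coefficients coming from the base field are fixed by the \<open>q\<close>-th power map,
  so only the point moves. Conjugates of a root are therefore roots.\<close>

lemma ev_frobenius: "ev p y ^ q = ev p (y ^ q)"
  using q_ge_2
  by (induction p) (simp_all add: frobenius_add frobenius_hom power_mult_distrib)

lemma ev_frobenius_power: "ev p y ^ (q ^ i) = ev p (y ^ (q ^ i))"
proof (induction i)
  case (Suc i)
  have "ev p y ^ (q ^ Suc i) = (ev p y ^ (q ^ i)) ^ q"
    by (simp add: mult.commute flip: power_mult)
  also have "\<dots> = ev p ((y ^ (q ^ i)) ^ q)"
    by (simp only: Suc.IH ev_frobenius)
  finally show ?case
    by (simp add: mult.commute flip: power_mult)
qed simp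

text \<open>The first \<open>N\<close> conjugates of \<open>y\<close> are all roots of
  \<open>g\<close>. They are distinct: by injectivity of the power map, a coincidence between two of
  them pulls back to a return to \<open>y\<close> in fewer than \<open>N\<close> steps.\<close>

lemma degree_ge_frobenius_orbit:
  assumes "ev g y = 0" "g \<noteq> 0" and orbit: "\<And>d. 0 < d \<Longrightarrow> d < N \<Longrightarrow> y ^ (q ^ d) \<noteq> y"
  shows "N \<le> degree g"
proof -
  have neq: "y ^ (q ^ i) \<noteq> y ^ (q ^ j)" if "i < j" "j < N" for i j
  proof
    assume eq: "y ^ (q ^ i) = y ^ (q ^ j)"
    have "q ^ j = q ^ (j - i) * q ^ i"
      using that by (simp flip: power_add)
    hence "(y ^ (q ^ (j - i))) ^ (q ^ i) = y ^ (q ^ i)"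
      using eq by (simp flip: power_mult)
    hence "y ^ (q ^ (j - i)) = y"
      by (rule frobenius_power_inj)
    thus False
      using orbit[of "j - i"] that by simp
  qed
  have "inj_on (\<lambda>i. y ^ (q ^ i)) {..<N}"
    by (rule linorder_inj_onI) (use neq in auto)
  hence "N = card ((\<lambda>i. y ^ (q ^ i)) ` {..<N})"
    by (simp add: card_image)
  also have "\<dots> \<le> card {x. ev g x = 0}"
  proof (intro card_mono poly_roots_finite image_subsetI)
    fix i
    show "y ^ (q ^ i) \<in> {x. ev g x = 0}"
      using ev_frobenius_power[of g y i] assms(1) by (simp add: power_0_left)
  qed (use assms in auto)
  also have "\<dots> \<le> degree (map_poly h g)"
    using assms by (intro card_poly_roots_bound) auto
  finally show ?thesis
    by simp
qed

text \<open>In a factorization of \<open>g\<close>, one factor vanishes at \<open>y\<close> and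
  hence at all its conjugates. That factor already has the full degree, so the other is
  constant.\<close>

lemma irreducible_if_frobenius_orbit:
  assumes "ev g y = 0" "degree g > 0"
    and orbit: "\<And>d. 0 < d \<Longrightarrow> d < degree g \<Longrightarrow> y ^ (q ^ d) \<noteq> y"
  shows "irreducible g"
proof (rule irreducibleI)
  show "g \<noteq> 0" "\<not> is_unit g"
    using assms(2) by (auto simp: is_unit_poly_iff)
  have unit: "is_unit b" if "g = a * b" "ev a y = 0" for a b
  proof -
    have nz: "a \<noteq> 0" "b \<noteq> 0"
      using that assms(2) by auto
    have "degree g \<le> degree a"
      using that(2) nz(1) orbit by (rule degree_ge_frobenius_orbit)
    thus ?thesis
      using nz that(1) by (simp add: degree_mult_eq is_unit_iff_degree)
  qed
  fix a b assume "g = a * b"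
  thus "is_unit a \<or> is_unit b"
    using unit[of a b] unit[of b a] assms(1) by (auto simp: mult.commute)
qed

text \<open>The \<open>q ^ (n + 1)\<close> combinations of \<open>1, c, \<dots>, c ^ n\<close> all lie among the at most
  \<open>q ^ n\<close> fixed points of the \<open>q ^ n\<close>-power map.\<close>
lemma exists_annihilator:
  assumes "c ^ (q ^ n) = c" "n > 0"
  shows "\<exists>g. g \<noteq> 0 \<and> degree g \<le> n \<and> ev g c = 0"
proof -
  define S where "S = {x :: 'b. x ^ (q ^ n) = x}"
  define P :: "'b poly" where "P = monom 1 (q ^ n) - [:0, 1:]"
  have gt1: "q ^ n > 1"
    using assms(2) q_ge_2 by (intro one_less_power) auto
  have "coeff P (q ^ n) = 1"
    using gt1 assms(2) q_ge_2 by (auto simp: P_def coeff_pCons split: nat.split)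
  hence P: "P \<noteq> 0"
    by auto
  have S: "S = {x. poly P x = 0}"
    by (auto simp: S_def P_def poly_monom)
  have "degree P \<le> q ^ n"
    unfolding P_def using gt1 by (intro degree_diff_le degree_monom_le) simp
  hence card_S: "finite S" "card S \<le> q ^ n"
    using poly_roots_finite[OF P] card_poly_roots_bound[OF P] by (simp_all add: S)
  \<comment> \<open>Extensional functions, so that \<open>W\<close> is finite and distinct members
    differ at some index \<open>i \<le> n\<close>, where \<open>p\<close> sees the
    difference.\<close>
  define W where "W = PiE {..n} (\<lambda>_. UNIV :: 'a set)"
  define p where "p w = (\<Sum>i\<le>n. monom (w i) i)" for w :: "nat \<Rightarrow> 'a"
  have "\<not> inj_on (\<lambda>w. ev (p w) c) W"
  proof (rule pigeonhole)
    have "(\<lambda>w. ev (p w) c) ` W \<subseteq> S"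
      using assms(1) by (auto simp: S_def ev_frobenius_power)
    hence "card ((\<lambda>w. ev (p w) c) ` W) \<le> q ^ n"
      using card_S by (meson card_mono le_trans)
    also have "\<dots> < card W"
      using q_ge_2 by (simp add: W_def card_PiE flip: q_eq_card)
    finally show "card ((\<lambda>w. ev (p w) c) ` W) < card W" .
  qed
  then obtain w w' where w: "w \<in> W" "w' \<in> W" "w \<noteq> w'" "ev (p w) c = ev (p w') c"
    by (auto simp: inj_on_def)
  have coeff: "coeff (p v) i = v i" if "i \<le> n" for v i
    using that by (simp add: p_def coeff_sum)
  obtain i where "i \<le> n" "w i \<noteq> w' i"
    using w(1-3) unfolding W_def by (metis PiE_ext atMost_iff)
  hence "p w \<noteq> p w'"
    by (metis coeff)
  moreover have "degree (p v) \<le> n" for v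
    unfolding p_def by (intro degree_sum_le) (auto intro: order.trans[OF degree_monom_le])
  ultimately show ?thesis
    using w(4) by (intro exI[of _ "p w - p w'"]) (auto intro: degree_diff_le)
qed

text \<open>Since \<open>f\<close> is irreducible, it divides x^t - 1 exactly when \<open>a\<close>
  is a root of the latter, so \<open>poly_ord f\<close> is the multiplicative order of
  \<open>a\<close>.\<close>

lemma power_eq_1_iff_poly_ord_dvd:
  assumes "irreducible f" "ev f a = 0" "a \<noteq> 0"
  shows "a ^ t = 1 \<longleftrightarrow> poly_ord f dvd t"
proof -
  have dvd_iff: "f dvd monom 1 t - 1 \<longleftrightarrow> a ^ t = 1" for t
  proof
    assume "a ^ t = 1"
    thus "f dvd monom 1 t - 1"
      using assms by (intro irreducible_dvd_if_common_root[of f a]) auto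
  next
    assume "f dvd monom 1 t - 1"
    then obtain g where "monom 1 t - 1 = f * g"
      by (elim dvdE)
    hence "ev (monom 1 t - 1) a = 0"
      using assms(2) by simp
    thus "a ^ t = 1"
      by simp
  qed
  \<comment> \<open>The \<open>LEAST\<close> needs a witness, and \<open>'b\<close> may be infinite.
    The conjugates of \<open>a\<close> lie among the finitely many roots of \<open>f\<close>, so two
    coincide, and cancelling gives a positive power equal to 1.\<close>
  have "finite (range (\<lambda>i. a ^ (q ^ i)))"
  proof (rule finite_subset)
    show "range (\<lambda>i. a ^ (q ^ i)) \<subseteq> {x. ev f x = 0}"
      using assms(2) q_ge_2 by (auto simp flip: ev_frobenius_power)
    show "finite {x. ev f x = 0}"
      using assms(1) by (intro poly_roots_finite) auto
  qed
  hence "\<not> inj (\<lambda>i. a ^ (q ^ i))"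
    using finite_imageD by blast
  then obtain i j where ij: "i < j" "a ^ (q ^ i) = a ^ (q ^ j)"
    by (auto simp: inj_def) (metis linorder_neqE_nat)
  have less: "q ^ i < q ^ j"
    using ij(1) q_ge_2 by (intro power_strict_increasing) auto
  hence "a ^ (q ^ j) = a ^ (q ^ i) * a ^ (q ^ j - q ^ i)"
    by (simp flip: power_add)
  hence "a ^ (q ^ j - q ^ i) = 1"
    using ij(2) assms(3) by simp
  hence ex: "\<exists>t>0. a ^ t = 1"
    using less by (intro exI[of _ "q ^ j - q ^ i"]) auto
  have ord: "poly_ord f = (LEAST t. 0 < t \<and> a ^ t = 1)"
    unfolding poly_ord_def dvd_iff ..
  have pos: "0 < poly_ord f" and one: "a ^ poly_ord f = 1"
    using LeastI_ex[OF ex] by (simp_all add: ord)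
  show ?thesis
  proof
    assume "a ^ t = 1"
    moreover have "a ^ t = (a ^ poly_ord f) ^ (t div poly_ord f) * a ^ (t mod poly_ord f)"
      by (simp flip: power_mult power_add)
    ultimately have "a ^ (t mod poly_ord f) = 1"
      by (simp add: one)
    hence "t mod poly_ord f = 0"
      using not_less_Least[of "t mod poly_ord f" "\<lambda>t. 0 < t \<and> a ^ t = 1"] pos
      by (auto simp flip: ord)
    thus "poly_ord f dvd t"
      by auto
  next
    assume "poly_ord f dvd t"
    thus "a ^ t = 1"
      by (auto simp: power_mult one)
  qed
qed

text \<open>Passing from \<open>a\<close> to \<open>a ^ e\<close> divides the order by
  \<open>e\<close>. The degree bound rules out that \<open>f\<close> is associated to x, so
  \<open>a\<close> is nonzero.\<close>

lemma power_root_eq_1_iff: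
  assumes "irreducible f" "ev f a = 0" "degree f > 1" "poly_ord f = e * s" "e > 0"
  shows "(a ^ e) ^ k = 1 \<longleftrightarrow> s dvd k"
proof -
  have "a \<noteq> 0"
  proof
    assume "a = 0"
    hence "f dvd [:0, 1:]"
      using assms(1,2) by (intro irreducible_dvd_if_common_root[of f a]) auto
    thus False
      using dvd_imp_degree_le[of f "[:0, 1:]"] assms(3) by simp
  qed
  thus ?thesis
    using power_eq_1_iff_poly_ord_dvd[OF assms(1,2), of "e * k"] assms(4,5)
    by (simp add: power_mult)
qed

end

section \<open>An element of order \<open>Q + 1\<close> and the Moebius transformation it
  defines\<close>

lemma inverse_pow_of_order:
  fixes b :: "'a::field"
  assumes ord: "\<And>k. b ^ k = 1 \<longleftrightarrow> (Q + 1) dvd k"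
  shows "b * b ^ Q = 1" "(b ^ Q) ^ Q = b"
proof -
  show 1: "b * b ^ Q = 1"
    using ord[of "Q + 1"] by simp
  have "(b * b ^ Q) ^ Q = b * b ^ Q"
    using 1 by simp
  hence "b ^ Q * (b ^ Q) ^ Q = b ^ Q * b"
    by (simp add: power_mult_distrib mult.commute)
  thus "(b ^ Q) ^ Q = b"
    using 1 by auto
qed

text \<open>The equation says \<open>y ^ Q = (c y - 1) / (y + 1)\<close>. This Moebius transformation has the fixed
  points \<open>b\<close> and \<open>1 / b\<close>, and in the coordinate \<open>(y - b) / (y - 1 / b)\<close> it is division
  by \<open>b\<close>.\<close>
lemma moebius_orbit:
  fixes b c y :: "'a::field"
  assumes add: "\<And>x y :: 'a. (x + y) ^ Q = x ^ Q + y ^ Q" and Q: "Q \<ge> 2"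
    and ord: "\<And>k. b ^ k = 1 \<longleftrightarrow> (Q + 1) dvd k"
    and c: "c = b ^ Q + b + 1"
    and y: "y ^ (Q + 1) + y ^ Q + 1 = c * y"
    and fix_y: "y ^ (Q ^ k) = y"
  shows "(Q + 1) dvd k"
proof -
  define b' where "b' = b ^ Q"
  note inv = inverse_pow_of_order[OF ord, folded b'_def]
  \<comment> \<open>\<open>Q + 1\<close> is at least 3, so it does not divide 2. Hence the two fixed
    points differ and \<open>b\<close> is not -1.\<close>
  have sq: "b ^ 2 \<noteq> 1"
    using Q ord[of 2] dvd_imp_le[of "Q + 1" 2] by auto
  hence neq: "b \<noteq> b'"
    using inv(1) by (auto simp: power2_eq_square)
  have nz1: "1 + b \<noteq> 0"
  proof
    assume "1 + b = 0"
    hence "b = - 1"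
      by (simp add: add_eq_0_iff)
    thus False
      using sq by simp
  qed
  \<comment> \<open>The two constants \<open>1 + b\<close> and \<open>1 + b'\<close> in
    \<open>step\<close> have quotient \<open>b\<close>: the multiplier.\<close>
  have b1: "1 + b = b * (1 + b')"
    using inv(1) by (simp add: algebra_simps)
  hence nz1': "1 + b' \<noteq> 0"
    using nz1 by auto
  have cQ: "c ^ Q = c"
    unfolding c by (simp add: add inv(2) flip: b'_def)
  define z where "z i = y ^ (Q ^ i)" for i
  have z_Suc: "z (Suc i) = z i ^ Q" for i
    by (simp add: z_def mult.commute flip: power_mult)
  have z: "z (Suc i) * z i + z (Suc i) + 1 = c * z i" for i
  proof (induction i)
    case 0
    show ?case
      using y by (simp add: z_def mult.commute)
  next
    case (Suc i)
    hence "(z (Suc i) * z i + z (Suc i) + 1) ^ Q = (c * z i) ^ Q"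
      by simp
    thus ?case
      by (simp add: add power_mult_distrib cQ z_Suc)
  qed
  \<comment> \<open>Both lines insert the relation \<open>z\<close> and use
    \<open>b * b' = 1\<close>. Their quotient is the action on the coordinate (z - b)/(z - b'), kept
    here free of denominators.\<close>
  have step: "(z (Suc i) - b) * (z i + 1) = (1 + b') * (z i - b)"
             "(z (Suc i) - b') * (z i + 1) = (1 + b) * (z i - b')" for i
  proof -
    have "(z (Suc i) - b) * (z i + 1) = (z (Suc i) * z i + z (Suc i) + 1) - b * b' - b * z i - b"
      by (simp add: inv(1) algebra_simps)
    also have "\<dots> = (1 + b') * (z i - b)"
      unfolding z c b'_def[symmetric] by (simp add: algebra_simps)
    finally show "(z (Suc i) - b) * (z i + 1) = (1 + b') * (z i - b)" .
    have "(z (Suc i) - b') * (z i + 1) = (z (Suc i) * z i + z (Suc i) + 1) - b * b' - b' * z i - b'"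
      by (simp add: inv(1) algebra_simps)
    also have "\<dots> = (1 + b) * (z i - b')"
      unfolding z c b'_def[symmetric] by (simp add: algebra_simps)
    finally show "(z (Suc i) - b') * (z i + 1) = (1 + b) * (z i - b')" .
  qed
  \<comment> \<open>The \<open>Q\<close>-th power map swaps \<open>b\<close> and \<open>b'\<close>,
    whereas \<open>step\<close> would keep an orbit point equal to either of them in place.\<close>
  have fixed: "z i \<noteq> b" "z i \<noteq> b'" for i
  proof -
    show "z i \<noteq> b"
    proof
      assume zi: "z i = b"
      hence "z (Suc i) = b'"
        by (simp add: z_Suc b'_def)
      with zi step(1)[of i] have "(b' - b) * (b + 1) = 0"
        by simp
      thus False
        using neq nz1 by (simp add: add.commute)
    qed
    show "z i \<noteq> b'"
    proof
      assume zi: "z i = b'"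
      hence "z (Suc i) = b"
        by (simp add: z_Suc inv)
      with zi step(2)[of i] have "(b - b') * (b' + 1) = 0"
        by simp
      thus False
        using neq nz1' by (simp add: add.commute)
    qed
  qed
  \<comment> \<open>After \<open>i\<close> steps the coordinate has been divided by
    \<open>b ^ i\<close>; this is that statement cross-multiplied.\<close>
  have coord: "(z i - b) * (z 0 - b') * b ^ i = (z 0 - b) * (z i - b')" for i
  proof (induction i)
    case (Suc i)
    have "z i + 1 \<noteq> 0"
      using step(1)[of i] nz1' fixed(1)[of i] by auto
    moreover have "(1 + b') * (z i + 1) * (b * (z (Suc i) - b) * (z i - b'))
        = (1 + b') * (z i + 1) * ((z (Suc i) - b') * (z i - b))"
    proof -
      have "(1 + b') * (z i + 1) * (b * (z (Suc i) - b) * (z i - b'))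
          = (b * (1 + b')) * ((z (Suc i) - b) * (z i + 1)) * (z i - b')"
        by (simp only: mult_ac)
      also have "\<dots> = (1 + b') * ((1 + b) * (z i - b')) * (z i - b)"
        unfolding step(1) b1[symmetric] by (simp only: mult_ac)
      also have "\<dots> = (1 + b') * (z i + 1) * ((z (Suc i) - b') * (z i - b))"
        unfolding step(2)[symmetric] by (simp only: mult_ac)
      finally show ?thesis .
    qed
    ultimately have eq: "b * (z (Suc i) - b) * (z i - b') = (z (Suc i) - b') * (z i - b)"
      using nz1' by simp
    have "(z i - b') * ((z (Suc i) - b) * (z 0 - b') * b ^ Suc i)
        = (b * (z (Suc i) - b) * (z i - b')) * ((z 0 - b') * b ^ i)"
      by (simp add: algebra_simps)
    also have "\<dots> = (z (Suc i) - b') * ((z i - b) * (z 0 - b') * b ^ i)"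
      by (simp add: eq)
    also have "\<dots> = (z i - b') * ((z 0 - b) * (z (Suc i) - b'))"
      by (simp add: Suc.IH)
    finally show ?case
      using fixed(2)[of i] by simp
  qed simp
  have "z k = z 0"
    using fix_y by (simp add: z_def)
  hence "b ^ k = 1"
    using coord[of k] fixed[of 0] by simp
  thus ?thesis
    by (simp add: ord)
qed

section \<open>Orbit lengths of \<open>c\<close> and of a root \<open>y\<close> under the
  \<open>q\<close>-th power map\<close>

context finite_field_embedding
begin

context
  fixes b c :: 'b and n :: nat
  assumes n: "n \<ge> 1"
    and ord: "\<And>k. b ^ k = 1 \<longleftrightarrow> (q ^ n + 1) dvd k"
    and c: "c = b ^ (q ^ n) + b + 1"
begin

lemma trace_fixed: "c ^ (q ^ n) = c"
  unfolding c by (simp add: frobenius_power_add inverse_pow_of_order(2)[OF ord] add.commute)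

text \<open>If \<open>c\<close> returned, then b^(q^d) and its inverse would have the same sum and
  product as \<open>b\<close> and its inverse, so b^(q^d) would be one of these two. Then
  \<open>q ^ n + 1\<close> would divide the smaller positive number \<open>q ^ d - 1\<close> or
  \<open>q ^ d + 1\<close>.\<close>

lemma trace_frobenius_orbit:
  assumes d: "0 < d" "d < n"
  shows "c ^ (q ^ d) \<noteq> c"
proof
  assume eq: "c ^ (q ^ d) = c"
  define b' where "b' = b ^ (q ^ n)"
  define B where "B = b ^ (q ^ d)"
  define B' where "B' = b' ^ (q ^ d)"
  have inv: "b * b' = 1"
    using inverse_pow_of_order(1)[OF ord] by (simp add: b'_def)
  have "B * B' = 1"
    unfolding B_def B'_def power_mult_distrib[symmetric] inv by simp
  moreover have "B' + B = b' + b"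
    using eq unfolding c by (simp add: frobenius_power_add B_def B'_def b'_def)
  moreover have "(B - b) * (B - b') = B * B - B * (b' + b) + b * b'"
    by (simp add: algebra_simps)
  ultimately have "(B - b) * (B - b') = B * B - B * (B' + B) + B * B'"
    using inv by simp
  hence "(B - b) * (B - b') = 0"
    by (simp add: algebra_simps)
  hence cases: "B = b \<or> B = b'"
    by simp
  have less: "q ^ d < q ^ n" "1 < q ^ d"
    using d q_ge_2 one_less_power[of q d] by (auto intro: power_strict_increasing)
  from cases show False
  proof
    assume "B = b"
    moreover have "B = b * b ^ (q ^ d - 1)"
      using power_minus_mult[of "q ^ d" b] less by (simp add: B_def mult.commute)
    moreover have "b \<noteq> 0"
      using inv by auto
    ultimately have "b ^ (q ^ d - 1) = 1"
      by simp
    hence "(q ^ n + 1) dvd (q ^ d - 1)"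
      by (simp only: ord)
    thus False
      using less by (auto dest: dvd_imp_le)
  next
    assume "B = b'"
    hence "b ^ (q ^ d + 1) = 1"
      using inv by (simp add: B_def)
    hence "(q ^ n + 1) dvd (q ^ d + 1)"
      by (simp only: ord)
    thus False
      using less by (auto dest: dvd_imp_le)
  qed
qed

text \<open>Reduce \<open>d\<close> modulo \<open>n\<close>: a nonzero remainder would be a return
  time shorter than \<open>n\<close>.\<close>

lemma trace_fixed_imp_dvd:
  assumes "c ^ (q ^ d) = c"
  shows "n dvd d"
proof -
  have fix_mult: "c ^ (q ^ (n * j)) = c" for j
    by (induction j) (simp_all add: power_add power_mult[of c] trace_fixed)
  have "c = (c ^ (q ^ (n * (d div n)))) ^ (q ^ (d mod n))"
    using assms by (simp flip: power_mult power_add)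
  hence "c ^ (q ^ (d mod n)) = c"
    by (simp add: fix_mult)
  hence "d mod n = 0"
    using trace_frobenius_orbit[of "d mod n"] n by auto
  thus ?thesis
    by auto
qed

text \<open>A power map fixing \<open>y\<close> also fixes \<open>c\<close>, as the equation
  determines \<open>c\<close> from the nonzero \<open>y\<close>. So \<open>d = n * k\<close>, and
  \<open>k\<close> steps of the \<open>q ^ n\<close>-th power map fix \<open>y\<close>; then
  \<open>moebius_orbit\<close> makes \<open>k\<close> a multiple of
  \<open>q ^ n + 1\<close>.\<close>

lemma moebius_root_frobenius_orbit:
  assumes y: "y ^ (q ^ n + 1) + y ^ (q ^ n) + 1 = c * y"
    and d: "0 < d" "d < n * (q ^ n + 1)"
  shows "y ^ (q ^ d) \<noteq> y"
proof
  assume fix_y: "y ^ (q ^ d) = y"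
  have y0: "y \<noteq> 0"
    using y by (auto simp: power_0_left)
  have "(c * y) ^ (q ^ d) = (y ^ (q ^ d)) ^ (q ^ n + 1) + (y ^ (q ^ d)) ^ (q ^ n) + 1"
    unfolding y[symmetric] frobenius_power_add
    by (simp add: power_mult_distrib mult.commute flip: power_mult)
  also have "\<dots> = c * y"
    by (simp only: fix_y y)
  finally have "c ^ (q ^ d) = c"
    using y0 by (simp add: power_mult_distrib fix_y)
  then obtain k where k: "d = n * k"
    using trace_fixed_imp_dvd by blast
  have "q ^ n \<ge> 2"
    using self_le_power[of q n] q_ge_2 n by simp
  moreover have "y ^ ((q ^ n) ^ k) = y"
    using fix_y by (simp add: k flip: power_mult)
  ultimately have "(q ^ n + 1) dvd k"
    using moebius_orbit[OF frobenius_power_add _ ord c y] by blast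
  thus False
    using d unfolding k mult_less_cancel1 by (auto dest: dvd_imp_le)
qed

end

end

section \<open>Degrees and roots of \<open>F_poly\<close> and of the polynomial in claim (a)\<close>

lemma degree_F_poly:
  fixes \<psi> :: "'a::field poly"
  assumes "degree \<psi> = n" "Q > 0" "n > 0"
  shows "degree (F_poly n Q \<psi>) = n * (Q + 1)"
proof -
  define S :: "'a poly" where "S = monom 1 (Q + 1) + monom 1 Q + 1"
  have "degree (monom 1 Q + 1 :: 'a poly) \<le> Q"
    by (intro degree_add_le degree_monom_le) auto
  hence "degree (monom 1 Q + 1 :: 'a poly) < degree (monom 1 (Q + 1) :: 'a poly)"
    by (simp add: degree_monom_eq)
  hence S: "degree S = Q + 1"
    unfolding S_def add.assoc by (simp add: degree_add_eq_left degree_monom_eq)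
  hence S0: "S \<noteq> 0"
    by auto
  define T where "T u = smult (coeff \<psi> u) (S ^ u * monom 1 (n - u))" for u
  \<comment> \<open>For \<open>u \<le> n\<close> this is \<open>n + u * Q\<close>, so the term with
    \<open>u = n\<close> strictly dominates.\<close>
  have deg: "degree (S ^ u * monom 1 (n - u)) = u * (Q + 1) + (n - u)" for u
    using S0 by (simp add: degree_mult_eq degree_power_eq S degree_monom_eq)
  have "coeff \<psi> n \<noteq> 0"
    using assms by auto
  hence top: "degree (T n) = n * (Q + 1)"
    using deg[of n] by (simp add: T_def)
  have "degree (\<Sum>u<n. T u) < n * (Q + 1)"
  proof (rule degree_sum_less)
    fix u assume "u \<in> {..<n}"
    hence "u * Q < n * Q" "u < n"
      using assms(2) by auto
    hence "u * (Q + 1) + (n - u) < n * (Q + 1)"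
      by simp
    thus "degree (T u) < n * (Q + 1)"
      using degree_smult_le[of "coeff \<psi> u" "S ^ u * monom 1 (n - u)"] unfolding T_def deg
      by linarith
  qed (use assms in auto)
  moreover have "F_poly n Q \<psi> = (\<Sum>u<n. T u) + T n"
    by (simp add: F_poly_def T_def S_def lessThan_Suc_atMost[symmetric])
  ultimately show ?thesis
    by (simp add: degree_add_eq_right top)
qed

text \<open>The equation for \<open>y\<close> turns the term of index \<open>u\<close> into y^n
  times the corresponding term of \<open>\<psi>\<close> at \<open>c\<close>, so \<open>y\<close> is
  a root of F whenever \<open>c\<close> is a root of \<open>\<psi>\<close>.\<close>

lemma (in field_embedding) ev_F_poly:
  assumes "degree \<psi> \<le> n" "y ^ (Q + 1) + y ^ Q + 1 = c * y"
  shows "ev (F_poly n Q \<psi>) y = y ^ n * ev \<psi> c"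
proof -
  have "ev (F_poly n Q \<psi>) y = (\<Sum>u\<le>n. h (coeff \<psi> u) * ((c * y) ^ u * y ^ (n - u)))"
    unfolding F_poly_def ev_sum using assms(2) by simp
  also have "\<dots> = (\<Sum>u\<le>n. y ^ n * (h (coeff \<psi> u) * c ^ u))"
  proof (intro sum.cong refl)
    fix u assume "u \<in> {..n}"
    hence "y ^ n = y ^ u * y ^ (n - u)"
      by (simp flip: power_add)
    thus "h (coeff \<psi> u) * ((c * y) ^ u * y ^ (n - u)) = y ^ n * (h (coeff \<psi> u) * c ^ u)"
      by (simp add: power_mult_distrib)
  qed
  also have "\<dots> = y ^ n * (\<Sum>u\<le>n. h (coeff \<psi> u) * c ^ u)"
    by (simp add: sum_distrib_left)
  also have "(\<Sum>u\<le>n. h (coeff \<psi> u) * c ^ u) = (\<Sum>u\<le>degree \<psi>. h (coeff \<psi> u) * c ^ u)"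
    using assms(1) by (intro sum.mono_neutral_right) (auto simp: coeff_eq_0)
  finally show ?thesis
    by (simp add: ev_altdef)
qed

text \<open>Its roots are the \<open>y\<close> with y^Q (y + 1) = c y - 1, the Moebius relation
  cleared of its denominator.\<close>

definition moebius_poly :: "nat \<Rightarrow> 'a::field \<Rightarrow> 'a poly" where
  "moebius_poly Q c = monom 1 (Q + 1) + monom 1 Q - [:0, c:] + 1"

lemma degree_moebius_poly:
  assumes "Q > 0"
  shows "degree (moebius_poly Q c) = Q + 1"
proof -
  have "degree (monom 1 Q - [:0, c:] + 1) \<le> Q"
    using assms by (intro degree_add_le degree_diff_le degree_monom_le) auto
  hence "degree (monom 1 Q - [:0, c:] + 1) < degree (monom 1 (Q + 1) :: 'a poly)"
    by (simp add: degree_monom_eq)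
  hence "degree (monom 1 (Q + 1) + (monom 1 Q - [:0, c:] + 1)) = Q + 1"
    by (subst degree_add_eq_left) (simp_all add: degree_monom_eq)
  thus ?thesis
    by (simp add: moebius_poly_def algebra_simps)
qed

lemma (in field_embedding) ev_moebius_poly:
  "ev (moebius_poly Q c) y = 0 \<longleftrightarrow> y ^ (Q + 1) + y ^ Q + 1 = h c * y"
  by (auto simp: moebius_poly_def algebra_simps)

lemma exists_moebius_root:
  fixes c :: "'a::alg_closed_field"
  assumes "Q > 0"
  shows "\<exists>y. y ^ (Q + 1) + y ^ Q + 1 = c * y"
proof -
  obtain y where "poly (moebius_poly Q c) y = 0"
    using alg_closed_imp_poly_has_root[of "moebius_poly Q c"] degree_moebius_poly[OF assms, of c]
    by auto
  thus ?thesis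
    by (intro exI[of _ y]) (simp add: moebius_poly_def poly_monom algebra_simps)
qed

section \<open>Irreducibility of the three polynomials\<close>

theorem mainTheorem11:
  fixes f :: "'k::{field,finite} poly"
    and \<phi> :: "'k \<Rightarrow> 'l::{field,finite}"
    and \<iota> :: "'m::{field,finite} \<Rightarrow> 'l"
    and q n e :: nat
  assumes q: "card (UNIV :: 'k set) = q"
    and n: "n \<ge> 1"
    and card_m: "card (UNIV :: 'm set) = q ^ n"
    and card_l: "card (UNIV :: 'l set) = q ^ (2 * n)"
    and hom_phi: "field_hom \<phi>"
    and hom_iota: "field_hom \<iota>"
    and monic: "lead_coeff f = 1"
    and irr: "irreducible f"
    and deg: "degree f = 2 * n"
    and e_pos: "e > 0"
    and ord: "poly_ord f = e * (q ^ n + 1)"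
  shows
    "(\<forall>(\<alpha>::'l) (c::'m). poly (map_poly \<phi> f) \<alpha> = 0 \<and>
         \<iota> c = (\<alpha> ^ e) ^ (q ^ n) + \<alpha> ^ e + 1 \<longrightarrow>
         irreducible (monom 1 (q ^ n + 1) + monom 1 (q ^ n) - [:0, c:] + 1 :: 'm poly))
     \<and>
     (\<forall>\<psi> :: 'k poly.
        let R = (monom 1 (e * q ^ n) + monom 1 e + 1) mod f in
        (lead_coeff \<psi> = 1 \<and> f dvd pcompose \<psi> R \<and>
         (\<forall>g :: 'k poly. g \<noteq> 0 \<and> lead_coeff g = 1 \<and> f dvd pcompose g R \<longrightarrow> degree \<psi> \<le> degree g))
        \<longrightarrow> irreducible \<psi> \<and> degree \<psi> = n \<and>
            irreducible (F_poly n (q ^ n) \<psi>) \<and> degree (F_poly n (q ^ n) \<psi>) = n * (q ^ n + 1))"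
proof -
  have qn: "q ^ n > 0"
    using finite_field_card_ge_2[where ?'a = 'k] q by simp
  have deg1: "degree f > 1"
    using deg n by simp
  show ?thesis
  proof (intro conjI allI impI)
    fix \<alpha> :: 'l and c :: 'm
    assume *: "poly (map_poly \<phi> f) \<alpha> = 0 \<and> \<iota> c = (\<alpha> ^ e) ^ (q ^ n) + \<alpha> ^ e + 1"
    \<comment> \<open>\<open>phi\<close> serves to compute the order of \<open>\<alpha> ^ e\<close>
      inside \<open>'l\<close>; \<open>toK\<close> then views \<open>'m\<close> as the base field,
      of cardinality \<open>q ^ n\<close>, inside an algebraic closure of \<open>'l\<close> that
      contains a root \<open>y\<close>.\<close>
    interpret phi: finite_field_embedding \<phi> q
      by unfold_locales (use hom_phi q in auto)
    interpret io: field_embedding \<iota>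
      by unfold_locales (rule hom_iota)
    interpret toK: finite_field_embedding "\<lambda>x. to_ac (\<iota> x)" "q ^ n"
      by unfold_locales (simp_all add: field_hom_def card_m)
    have ord_l: "(\<alpha> ^ e) ^ k = 1 \<longleftrightarrow> (q ^ n + 1) dvd k" for k
      using * by (intro phi.power_root_eq_1_iff[OF irr _ deg1 ord e_pos]) simp
    define b where "b = to_ac (\<alpha> ^ e)"
    \<comment> \<open>Over the base field \<open>'m\<close> the orbit lemmas are used with their
      \<open>n\<close> equal to 1, whence the exponent \<open>(q ^ n) ^ 1\<close>.\<close>
    have ord_b: "b ^ k = 1 \<longleftrightarrow> ((q ^ n) ^ 1 + 1) dvd k" for k
      using ord_l[of k] unfolding b_def by (metis power_one_right to_ac_1 to_ac_eq_iff to_ac_power)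
    have c: "to_ac (\<iota> c) = b ^ ((q ^ n) ^ 1) + b + 1"
      using * by (simp add: b_def)
    obtain y where y: "y ^ (q ^ n + 1) + y ^ (q ^ n) + 1 = to_ac (\<iota> c) * y"
      using exists_moebius_root[OF qn] by blast
    have "irreducible (moebius_poly (q ^ n) c)"
    proof (rule toK.irreducible_if_frobenius_orbit)
      show "toK.ev (moebius_poly (q ^ n) c) y = 0"
        using y by (simp only: toK.ev_moebius_poly)
      fix d assume "0 < d" "d < degree (moebius_poly (q ^ n) c)"
      thus "y ^ ((q ^ n) ^ d) \<noteq> y"
        using y by (intro toK.moebius_root_frobenius_orbit[OF _ ord_b c])
          (simp_all add: degree_moebius_poly[OF qn])
    qed (simp add: degree_moebius_poly[OF qn])
    thus "irreducible (monom 1 (q ^ n + 1) + monom 1 (q ^ n) - [:0, c:] + 1 :: 'm poly)"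
      by (simp only: moebius_poly_def)
  next
    fix \<psi> :: "'k poly"
    interpret K: finite_field_embedding "to_ac :: 'k \<Rightarrow> 'k alg_closure" q
      by unfold_locales (simp_all add: field_hom_def q)
    obtain a where a: "K.ev f a = 0"
      using alg_closed_imp_poly_has_root[of "map_poly to_ac f"] deg1 by auto
    define b where "b = a ^ e"
    define c where "c = b ^ (q ^ n) + b + 1"
    have ord_b: "b ^ k = 1 \<longleftrightarrow> (q ^ n + 1) dvd k" for k
      unfolding b_def by (rule K.power_root_eq_1_iff[OF irr a deg1 ord e_pos])
    define R where "R = (monom 1 (e * q ^ n) + monom 1 e + 1) mod f"
    have "K.ev R a = c"
      by (simp add: R_def K.ev_mod[OF a] c_def b_def flip: power_mult)
    hence ev_comp: "K.ev (pcompose g R) a = K.ev g c" for g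
      by (simp add: K.ev_pcompose)
    \<comment> \<open>Because R takes the value \<open>c\<close> at \<open>a\<close>, the condition
      on \<open>\<psi>\<close> says precisely that it is the minimal polynomial of
      \<open>c\<close>.\<close>
    have dvd_iff: "f dvd pcompose g R \<longleftrightarrow> K.ev g c = 0" for g
    proof
      assume "f dvd pcompose g R"
      then obtain s where "pcompose g R = f * s"
        by (elim dvdE)
      thus "K.ev g c = 0"
        using a ev_comp[of g] by simp
    next
      assume "K.ev g c = 0"
      thus "f dvd pcompose g R"
        using ev_comp[of g] by (intro K.irreducible_dvd_if_common_root[OF irr a]) simp
    qed
    show "let R = (monom 1 (e * q ^ n) + monom 1 e + 1) mod f in
          (lead_coeff \<psi> = 1 \<and> f dvd pcompose \<psi> R \<and>
           (\<forall>g :: 'k poly. g \<noteq> 0 \<and> lead_coeff g = 1 \<and> f dvd pcompose g R \<longrightarrow> degree \<psi> \<le> degree g))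
          \<longrightarrow> irreducible \<psi> \<and> degree \<psi> = n \<and>
              irreducible (F_poly n (q ^ n) \<psi>) \<and> degree (F_poly n (q ^ n) \<psi>) = n * (q ^ n + 1)"
      unfolding Let_def R_def[symmetric] dvd_iff
    proof (intro impI, elim conjE)
      assume lead: "lead_coeff \<psi> = 1" and root: "K.ev \<psi> c = 0"
        and min: "\<forall>g. g \<noteq> 0 \<and> lead_coeff g = 1 \<and> K.ev g c = 0 \<longrightarrow> degree \<psi> \<le> degree g"
      have psi0: "\<psi> \<noteq> 0"
        using lead by auto
      have orbit_c: "c ^ (q ^ d) \<noteq> c" if "0 < d" "d < n" for d
        by (rule K.trace_frobenius_orbit[OF n ord_b c_def that])
      have fixed_c: "c ^ (q ^ n) = c"
        by (rule K.trace_fixed[OF n ord_b c_def])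
      have "n \<le> degree \<psi>"
        using root psi0 orbit_c by (rule K.degree_ge_frobenius_orbit)
      moreover have "degree \<psi> \<le> n"
      proof -
        obtain g where g: "g \<noteq> 0" "degree g \<le> n" "K.ev g c = 0"
          using K.exists_annihilator[OF fixed_c] n by auto
        \<comment> \<open>\<open>min\<close> compares with monic polynomials only, so
          \<open>g\<close> is normalised first.\<close>
        have "degree \<psi> \<le> degree (smult (inverse (lead_coeff g)) g)"
          using g by (intro min[rule_format]) simp
        thus ?thesis
          using g by simp
      qed
      ultimately have deg_psi: "degree \<psi> = n"
        by simp
      have irr_psi: "irreducible \<psi>"
        using root orbit_c n by (intro K.irreducible_if_frobenius_orbit[of \<psi> c]) (auto simp: deg_psi)
      have deg_F: "degree (F_poly n (q ^ n) \<psi>) = n * (q ^ n + 1)"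
        using n qn deg_psi by (intro degree_F_poly) auto
      obtain y where y: "y ^ (q ^ n + 1) + y ^ (q ^ n) + 1 = c * y"
        using exists_moebius_root[OF qn] by blast
      have "irreducible (F_poly n (q ^ n) \<psi>)"
      proof (rule K.irreducible_if_frobenius_orbit)
        show "K.ev (F_poly n (q ^ n) \<psi>) y = 0"
          using K.ev_F_poly[OF _ y, of \<psi> n] deg_psi root by simp
        show "degree (F_poly n (q ^ n) \<psi>) > 0"
          using n by (simp add: deg_F)
        fix d assume "0 < d" "d < degree (F_poly n (q ^ n) \<psi>)"
        thus "y ^ (q ^ d) \<noteq> y"
          unfolding deg_F
          by (intro K.moebius_root_frobenius_orbit[OF n ord_b c_def]) (simp_all only: y)
      qed
      thus "irreducible \<psi> \<and> degree \<psi> = n \<and>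
          irreducible (F_poly n (q ^ n) \<psi>) \<and> degree (F_poly n (q ^ n) \<psi>) = n * (q ^ n + 1)"
        using irr_psi deg_psi deg_F by blast
    qed
  qed
qed

end
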